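(* Let $F$ be a field and let $A(u), B(u), P(u) \in F[u]$ satisfy $0 \le \deg(A(u)), \deg(B(u)) < \deg(P(u)) = N$. Put $X(u) = A(u)\cdot B(u)$, so that $\deg(X(u)) \le 2N-2$. Let $G(u), H(u) \in F[u]$ be nonzero polynomials with $\alpha = \deg(G(u))$ and $\beta = \deg(H(u))$ such that $$\deg(X(u)) \le 2N-2 \le \alpha+\beta \quad\text{and}\quad \alpha \le \deg(P(u)) = N .$$ Let $\mu(u) = \left\lfloor \dfrac{G(u)\cdot H(u)}{P(u)} \right\rfloor$. Then $$\left\lfloor \frac{\left\lfloor \frac{X(u)}{G(u)} \right\rfloor \cdot \mu(u)}{H(u)} \right\rfloor = \left\lfloor \frac{X(u)}{P(u)} \right\rfloor .$$
   Context: For polynomials $V(u), S(u) \in F[u]$ with $S(u) \ne 0$, the polynomial floor $\left\lfloor V(u)/S(u) \right\rfloor$ denotes the quotient in Euclidean division of $V(u)$ by $S(u)$, i.e. the unique polynomial $q(u)$ with $V(u) = q(u) S(u) + r(u)$ and $r(u)=0$ or $\deg(r(u)) < \deg(S(u))$. In particular it is $0$ if $\deg(V(u)) < \deg(S(u))$. *)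

theory Defs
  imports "HOL-Computational_Algebra.Polynomial"
begin

(* The polynomial floor of V/S is the library's V div S on 'a poly for a field 'a;
   the lemma confirms that it is the Euclidean quotient.
   Pitfall: degree 0 = 0 here, so "r = 0" has to be a separate alternative. *)
lemma poly_floor_unique:
  fixes V S q r :: "'a::field poly"
  assumes "S \<noteq> 0"
    and "V = q * S + r"
    and "r = 0 \<or> degree r < degree S"
  shows "V div S = q"
proof (cases "r = 0")
  case True
  then show ?thesis using assms by simp
next
  case False
  then have "degree r < degree S" using assms by simp
  then show ?thesis using assms by (simp add: div_poly_less poly_div_add_left)
qed

end

theory Submission
  imports Defs
begin

text \<open>
  Let \<open>r\<close>, \<open>s\<close> and \<open>t\<close> be the remainders of \<open>X\<close> by \<open>G\<close>, of \<open>X\<close> by \<open>P\<close> and of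
  \<open>G * H\<close> by \<open>P\<close>. By uniqueness of Euclidean division, the claim says that
  \<open>D = (X div G) * \<mu> - (X div P) * H\<close> is zero or has smaller degree than \<open>H\<close>. Both
  products approximate \<open>X * H / P\<close>, as \<open>X div G\<close> and \<open>\<mu>\<close> approximate \<open>X / G\<close> and
  \<open>G * H / P\<close>. Multiplying \<open>D\<close> by \<open>G * P\<close> clears denominators and the copies of
  \<open>X * G * H\<close> cancel, leaving (lemma \<open>nested_quotient_error\<close>)
  \<open>s * (G * H) - r * (\<mu> * P) - X * t\<close>. Put \<open>P\<close>, \<open>G\<close>, \<open>P\<close> back in place of the
  remainders \<open>s\<close>, \<open>r\<close>, \<open>t\<close>: the three products then have degree at most
  \<open>degree (G * H * P)\<close>, the first trivially, the second because \<open>\<alpha> \<le> N\<close>, the third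
  because \<open>degree X \<le> \<alpha> + \<beta>\<close>. Since a nonzero remainder has smaller degree than its divisor,
  \<open>degree (D * (G * P)) < degree (G * H * P)\<close>, so \<open>D\<close> is zero or \<open>degree D < degree H\<close>.
\<close>

lemma degree_div_mult_le:
  fixes p q :: "'a::field poly"
  shows "degree (p div q * q) \<le> degree p"
proof (cases "q = 0 \<or> degree p < degree q")
  case True
  then show ?thesis by (auto simp: div_poly_less)
next
  case False
  then have "degree (p mod q) \<le> degree p"
    using degree_mod_less[of q p] by auto
  then have "degree (p - p mod q) \<le> degree p"
    by (intro degree_diff_le) auto
  then show ?thesis by (simp add: minus_mod_eq_div_mult)
qed

text \<open>
  The error identity behind the main estimate. The second error keeps its factor
  \<open>G * H div P * P\<close> whole: expanding it as \<open>G * H\<close> minus a remainder would produce a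
  product of two remainders as a fourth term.
\<close>

lemma nested_quotient_error:
  fixes X G H P :: "'a::field poly"
  shows "((X div G) * (G * H div P) - (X div P) * H) * (G * P)
    = (X mod P) * (G * H) - (X mod G) * (G * H div P * P) - X * (G * H mod P)"
proof -
  define Y \<mu> q where "Y = X div G" and "\<mu> = G * H div P" and "q = X div P"
  define r t s where "r = X mod G" and "t = G * H mod P" and "s = X mod P"
  have r: "r = X - Y * G" and t: "t = G * H - \<mu> * P" and s: "s = X - q * P"
    unfolding Y_def \<mu>_def q_def r_def t_def s_def by (simp_all add: minus_div_mult_eq_mod)
  have "(Y * \<mu> - q * H) * (G * P) = s * (G * H) - r * (\<mu> * P) - X * t"
    unfolding r t s by (simp add: algebra_simps)
  then show ?thesis
    unfolding Y_def \<mu>_def q_def r_def t_def s_def .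
qed

theorem theorem1:
  fixes A B P X G H \<mu> :: "'a::field poly"
    and N \<alpha> \<beta> :: nat
  assumes "degree P = N"
    and "degree A < N"
    and "degree B < N"
    and "X = A * B"
    and "G \<noteq> 0"
    and "H \<noteq> 0"
    and "\<alpha> = degree G"
    and "\<beta> = degree H"
    and "degree X \<le> 2 * N - 2"
    and "2 * N - 2 \<le> \<alpha> + \<beta>"
    and "\<alpha> \<le> N"
    and "\<mu> = (G * H) div P"
  shows "((X div G) * \<mu>) div H = X div P"
proof -
  define D where "D = (X div G) * \<mu> - (X div P) * H"
  have N: "N > 0" and P: "P \<noteq> 0"
    using assms(1,2) by auto
  have GH: "degree (G * H) = \<alpha> + \<beta>"
    using assms(5-8) by (simp add: degree_mult_eq)
  have mod_P: "degree (p mod P) < N" for p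
    using degree_mod_less[OF P, of p] N assms(1) by auto
  have "degree ((X mod P) * (G * H)) < \<alpha> + \<beta> + N"
    using degree_mult_le[of "X mod P" "G * H"] mod_P[of X] GH by linarith
  moreover have "degree ((X mod G) * (\<mu> * P)) < \<alpha> + \<beta> + N"
  proof (cases "X mod G = 0")
    case True
    then show ?thesis using N by simp
  next
    case False
    then have "degree (X mod G) < \<alpha>"
      using degree_mod_less[OF assms(5), of X] assms(7) by simp
    moreover have "degree (\<mu> * P) \<le> \<alpha> + \<beta>"
      unfolding assms(12) using degree_div_mult_le[of "G * H" P] GH by simp
    ultimately show ?thesis
      using degree_mult_le[of "X mod G" "\<mu> * P"] assms(11) by linarith
  qed
  moreover have "degree (X * (G * H mod P)) < \<alpha> + \<beta> + N"
    using degree_mult_le[of X "G * H mod P"] mod_P[of "G * H"] assms(9,10) by linarith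
  ultimately have less: "degree (D * (G * P)) < \<alpha> + \<beta> + N"
    unfolding D_def assms(12) nested_quotient_error by (intro degree_diff_less)
  have "D = 0 \<or> degree D < degree H"
  proof (cases "D = 0")
    case False
    then have "degree (D * (G * P)) = degree D + (\<alpha> + N)"
      using P assms(1,5,7) by (simp add: degree_mult_eq)
    then show ?thesis using less assms(8) by linarith
  qed simp
  moreover have "(X div G) * \<mu> = (X div P) * H + D"
    unfolding D_def by simp
  ultimately show ?thesis
    using poly_floor_unique[OF assms(6)] by blast
qed

end
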